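(* Let $a>0$ and $\xi>0$, and assume that $\rho_a$ is three times continuously differentiable in a neighborhood of $\psi_a(\xi)$. Then, as $h=h(n)\to 0$ and $n\to\infty$, $$\mathbb{E}\left[\widehat g_{n,h,a}(\xi)\right]-g(\xi)=h^2\,\frac{\psi_a'(\xi)\,\rho_a''(\psi_a(\xi))}{2\,\xi^{(d-2)/2}}\int_{\mathbb{R}}K(w)w^2\,dw+O(h^3),$$ and $$\operatorname{Var}\left[\widehat g_{n,h,a}(\xi)\right]=\frac{\psi_a'(\xi)\,g(\xi)\,\|K\|_2^2}{n\,h\,s_d\,\xi^{(d-2)/2}}+o\big((nh)^{-1}\big).$$
   Context: Let $d\ge 1$ be an integer, $\boldsymbol\mu\in\mathbb{R}^d$, $\boldsymbol\Sigma$ a symmetric positive definite $d\times d$ matrix (both known), and $g:\mathbb{R}_+\to\mathbb{R}_+$ such that $f(\mathbf{x})=|\boldsymbol\Sigma|^{-1/2}g\big((\mathbf{x}-\boldsymbol\mu)^\top\boldsymbol\Sigma^{-1}(\mathbf{x}-\boldsymbol\mu)\big)$ is a probability density on $\mathbb{R}^d$. Let $\mathbf{X}_1,\dots,\mathbf{X}_n$ be i.i.d. with density $f$ and $\xi_i:=(\mathbf{X}_i-\boldsymbol\mu)^\top\boldsymbol\Sigma^{-1}(\mathbf{X}_i-\boldsymbol\mu)$. For $a>0$ let $\psi_a(\xi):=-a+(a^{d/2}+\xi^{d/2})^{2/d}$ for $\xi\ge 0$ (an increasing bijection of $[0,\infty)$), and for $\xi>0$ let $z_a(\xi):=\xi^{(d-2)/2}g(\xi)/\psi_a'(\xi)$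 and $\rho_a:=z_a\circ\psi_a^{-1}$. Let $s_d:=\pi^{d/2}/\Gamma(d/2)$. The kernel $K:\mathbb{R}\to\mathbb{R}$ is bounded, measurable, compactly supported, symmetric, with $K(0)=1$ and $\int K=1$; $\|K\|_2^2=\int_{\mathbb{R}} K(w)^2\,dw$. The bandwidth is $h=h(n)>0$. The estimator is $$\widehat g_{n,h,a}(\xi):=\frac{\xi^{(-d+2)/2}\,\psi_a'(\xi)}{n h s_d}\sum_{i=1}^n\left[K\left(\frac{\psi_a(\xi)-\psi_a(\xi_i)}{h}\right)+K\left(\frac{\psi_a(\xi)+\psi_a(\xi_i)}{h}\right)\right].$$ The point $\xi$, the parameter $a$, $g$ and $K$ are fixed; the $O$ and $o$ terms may depend on them. *)

theory Defs
  imports "HOL-Probability.Probability" "HOL-Library.Landau_Symbols"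
begin

definition pos_def_matrix :: "real ^ 'n ^ 'n \<Rightarrow> bool" where
  "pos_def_matrix S \<longleftrightarrow> transpose S = S \<and> (\<forall>v. v \<noteq> 0 \<longrightarrow> 0 < v \<bullet> (S *v v))"

definition mahalanobis_sq :: "real ^ 'n \<Rightarrow> real ^ 'n ^ 'n \<Rightarrow> real ^ 'n \<Rightarrow> real" where
  "mahalanobis_sq \<mu> S x = (x - \<mu>) \<bullet> (matrix_inv S *v (x - \<mu>))"

definition elliptical_density ::
  "real ^ 'n \<Rightarrow> real ^ 'n ^ 'n \<Rightarrow> (real \<Rightarrow> real) \<Rightarrow> real ^ 'n \<Rightarrow> real" where
  "elliptical_density \<mu> S g x = (det S) powr (- 1 / 2) * g (mahalanobis_sq \<mu> S x)"

text \<open>In the following, \<open>d\<close> is the dimension. Functions on \<open>[0, \<infinity>)\<close> or \<open>(0, \<infinity>)\<close> are represented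
  by functions on all reals, whose values outside these domains carry no meaning.\<close>

definition psi :: "nat \<Rightarrow> real \<Rightarrow> real \<Rightarrow> real" where
  "psi d a t = - a + (a powr (real d / 2) + t powr (real d / 2)) powr (2 / real d)"

definition psi_inv :: "nat \<Rightarrow> real \<Rightarrow> real \<Rightarrow> real" where
  "psi_inv d a = inv_into {0..} (psi d a)"

definition z_fun :: "nat \<Rightarrow> real \<Rightarrow> (real \<Rightarrow> real) \<Rightarrow> real \<Rightarrow> real" where
  "z_fun d a g t = t powr ((real d - 2) / 2) * g t / deriv (psi d a) t"

definition rho :: "nat \<Rightarrow> real \<Rightarrow> (real \<Rightarrow> real) \<Rightarrow> real \<Rightarrow> real" where
  "rho d a g = z_fun d a g \<circ> psi_inv d a"

definition s_const :: "nat \<Rightarrow> real" where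
  "s_const d = pi powr (real d / 2) / Gamma (real d / 2)"

text \<open>\<open>k\<close> times continuously differentiable in a neighbourhood of the point \<open>x\<close>.\<close>

definition cont_diff_near :: "nat \<Rightarrow> (real \<Rightarrow> real) \<Rightarrow> real \<Rightarrow> bool" where
  "cont_diff_near k f x \<longleftrightarrow>
     (\<exists>U. open U \<and> x \<in> U \<and>
        (\<forall>j<k. \<forall>y\<in>U. (deriv ^^ j) f differentiable at y) \<and>
        continuous_on U ((deriv ^^ k) f))"

definition smoothing_kernel :: "(real \<Rightarrow> real) \<Rightarrow> bool" where
  "smoothing_kernel K \<longleftrightarrow>
     bounded (range K) \<and> K \<in> borel_measurable borel \<and> compact (closure {w. K w \<noteq> 0}) \<and>
     (\<forall>w. K (- w) = K w) \<and> K 0 = 1 \<and> (LBINT w. K w) = 1"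

text \<open>The estimator as a function of the values \<open>xs 1, \<dots>, xs n\<close> of the squared Mahalanobis
  distances of the sample points.\<close>

definition g_hat ::
  "nat \<Rightarrow> (real \<Rightarrow> real) \<Rightarrow> nat \<Rightarrow> real \<Rightarrow> real \<Rightarrow> (nat \<Rightarrow> real) \<Rightarrow> real \<Rightarrow> real" where
  "g_hat d K n h a xs t =
     t powr ((- real d + 2) / 2) * deriv (psi d a) t / (real n * h * s_const d) *
     (\<Sum>i=1..n. K ((psi d a t - psi d a (xs i)) / h) + K ((psi d a t + psi d a (xs i)) / h))"

end

theory Submission
  imports Defs
begin

text \<open>
  The squared Mahalanobis distance is a positive definite quadratic form, so its sublevel sets are
  ellipsoids of volume proportional to \<open>t powr (d / 2)\<close>. Since \<open>(psi t + a) powr (d / 2)\<close> equals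
  \<open>t powr (d / 2) + a powr (d / 2)\<close>, the transformed distance \<open>psi \<xi>\<^sub>i\<close> has density
  \<open>s_const d * rho\<close> on the positive half-line. The estimator is thus a kernel density estimator with
  reflection at \<open>0\<close>, evaluated at \<open>y = psi \<xi> > 0\<close> and rescaled. For small \<open>h\<close> the compactly
  supported kernel sees neither the boundary nor the reflected points, and the moments reduce to
  \<open>\<integral> K(w)^k rho(y - h w) dw\<close> for \<open>k = 1, 2\<close>, which are expanded by Taylor's formula.
\<close>

subsection \<open>Volume of ellipsoids\<close>

text \<open>The matrix of a shear arises from the identity by adding row \<open>n\<close> to row
  \<open>m\<close>, which preserves the determinant.\<close>

lemma det_shear:
  fixes m n :: "'n::finite"
  assumes "m \<noteq> n"
  shows "det (matrix (\<lambda>v::real^'n. \<chi> i. if i = m then v $ m + v $ n else v $ i)) = 1"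
proof -
  let ?I = "mat 1 :: real^'n^'n"
  have "matrix (\<lambda>v::real^'n. \<chi> i. if i = m then v $ m + v $ n else v $ i) =
      (\<chi> k. if k = m then row m ?I + 1 *s row n ?I else row k ?I)"
    by (simp add: vec_eq_iff matrix_def row_def mat_def axis_def eq_commute)
  then show ?thesis
    using det_row_operation[OF assms, of ?I 1] by simp
qed

text \<open>The library proves this for well-ordered index types only, which are needed there to compute
  the determinant of a shear by triangularity.\<close>

lemma lmeasurable_linear_image_det:
  fixes f :: "real^'n \<Rightarrow> real^'n"
  assumes "linear f" "S \<in> lmeasurable"
  shows "f ` S \<in> lmeasurable \<and> measure lebesgue (f ` S) = \<bar>det (matrix f)\<bar> * measure lebesgue S"
proof -
  let ?P = "\<lambda>f::real^'n \<Rightarrow> real^'n. \<forall>S \<in> lmeasurable.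
    f ` S \<in> lmeasurable \<and> measure lebesgue (f ` S) = \<bar>det (matrix f)\<bar> * measure lebesgue S"
  have "?P f"
    using \<open>linear f\<close>
  \<comment> \<open>Linear maps are composed of maps with a vanishing coordinate, coordinate
    scalings, swaps of two coordinates and shears; the formula passes to compositions because
    determinants multiply.\<close>
  proof (rule induct_linear_elementary[where P = ?P])
    fix f g :: "real^'n \<Rightarrow> real^'n"
    assume "linear f" "linear g" "?P f" "?P g"
    then show "?P (f \<circ> g)"
      unfolding image_comp[symmetric] by (simp add: matrix_compose det_mul abs_mult)
  next
    fix f :: "real^'n \<Rightarrow> real^'n" and i
    assume f: "linear f" "\<And>x. f x $ i = 0"
    \<comment> \<open>The range misses \<open>axis i 1\<close>, so the map is singular: its
      determinant is \<open>0\<close> and its images are null sets.\<close>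
    have "f x \<noteq> axis i 1" for x
      using f(2)[of x] by auto
    then have "\<not> surj f"
      by (metis surjD)
    then have inj: "\<not> inj f"
      using f(1) linear_injective_imp_surjective by blast
    then have "det (matrix f) = 0"
      using det_nz_iff_inj[OF f(1)] by blast
    moreover have "negligible (f ` S)" for S
      using negligible_linear_singular_image[OF f(1) inj] .
    ultimately show "?P f"
      by (simp add: negligible_iff_measure)
  next
    fix c :: "'n \<Rightarrow> real"
    show "?P (\<lambda>x. \<chi> i. c i * x $ i)"
      by (simp add: measurable_stretch measure_stretch axis_def matrix_def det_diagonal)
  next
    fix m n :: 'n
    assume "m \<noteq> n"
    let ?t = "Transposition.transpose m n"
    let ?h = "\<lambda>v::real^'n. \<chi> i. v $ ?t i"
    have lin: "linear ?h"
      by (rule linearI) (simp_all add: vec_eq_iff)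
    \<comment> \<open>For swaps and shears it is enough to treat boxes. A swap sends a box to the
      box with permuted corners.\<close>
    have img: "?h ` cbox a b = cbox (?h a) (?h b)" for a b
    proof (intro equalityI subsetI)
      fix x assume "x \<in> cbox (?h a) (?h b)"
      then have "a $ ?t (?t i) \<le> x $ ?t i \<and> x $ ?t i \<le> b $ ?t (?t i)" for i
        by (simp only: mem_box_cart vec_lambda_beta)
      then have "?h x \<in> cbox a b"
        by (simp only: mem_box_cart vec_lambda_beta transpose_involutory) blast
      moreover have "x = ?h (?h x)"
        by (simp add: vec_eq_iff)
      ultimately show "x \<in> ?h ` cbox a b"
        by blast
    qed (auto simp: mem_box_cart)
    have "measure lebesgue (?h ` cbox a b) = 1 * measure lebesgue (cbox a b)" for a b
    proof (cases "cbox a b = {}")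
      case False
      then have "cbox (?h a) (?h b) \<noteq> {}"
        by (simp add: img[symmetric])
      moreover have "(\<Prod>i\<in>UNIV. b $ ?t i - a $ ?t i) = (\<Prod>i\<in>UNIV. b $ i - a $ i)"
        using prod.permute[OF permutes_swap_id, of m UNIV n "\<lambda>i. b $ i - a $ i"]
        by (simp add: o_def)
      ultimately show ?thesis
        using False by (simp add: img content_cbox_cart)
    qed simp
    then have *: "?h ` S \<in> lmeasurable \<and> measure lebesgue (?h ` S) = measure lebesgue S"
      if "S \<in> lmeasurable" for S
      using measure_linear_sufficient[OF lin that, of 1] by simp
    have "matrix ?h = (\<chi> i. mat 1 $ ?t i)"
      by (auto simp: vec_eq_iff matrix_def mat_def axis_def)
    then have "\<bar>det (matrix ?h)\<bar> = 1"
      by (simp add: det_permute_rows[OF permutes_swap_id] abs_mult sign_def)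
    then show "?P ?h"
      using * by simp
  next
    fix m n :: 'n
    assume mn: "m \<noteq> n"
    let ?h = "\<lambda>v::real^'n. \<chi> i. if i = m then v $ m + v $ n else v $ i"
    have lin: "linear ?h"
      by (rule linearI) (auto simp: vec_eq_iff algebra_simps)
    have nonneg: "measure lebesgue (?h ` cbox a b) = measure lebesgue (cbox a b)"
      if "cbox a b \<noteq> {}" "0 \<le> a $ n" for a b
      using measure_shear_interval[OF mn that] by simp
    have "measure lebesgue (?h ` cbox a b) = 1 * measure lebesgue (cbox a b)" for a b
    proof (cases "cbox a b = {}")
      case False
      \<comment> \<open>The volume formula for sheared boxes asks for \<open>0 \<le> a $ n\<close>.
        Translation by \<open>c\<close> moves this coordinate to \<open>0\<close> and, by linearity,
        only translates the image.\<close>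
      define c :: "real^'n" where "c = axis n (- (a $ n))"
      have "?h ` cbox (c + a) (c + b) = (+) (?h c) ` ?h ` cbox a b"
        unfolding cbox_translation image_comp o_def linear_add[OF lin] ..
      then have "measure lebesgue (?h ` cbox a b) = measure lebesgue (?h ` cbox (c + a) (c + b))"
        by (simp only: measure_translation)
      also have "\<dots> = measure lebesgue (cbox (c + a) (c + b))"
        using False by (intro nonneg) (auto simp: cbox_translation c_def)
      also have "\<dots> = measure lebesgue (cbox a b)"
        by (simp only: cbox_translation measure_translation)
      finally show ?thesis
        by simp
    qed simp
    then have "?h ` S \<in> lmeasurable \<and> measure lebesgue (?h ` S) = measure lebesgue S"
      if "S \<in> lmeasurable" for S
      using measure_linear_sufficient[OF lin that, of 1] by simp
    then show "?P ?h"
      using det_shear[OF mn] by simp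
  qed
  then show ?thesis
    using assms(2) by blast
qed

section \<open>Whitening a positive definite quadratic form\<close>

lemma matrix_inv_unique:
  fixes A B :: "real^'n^'n"
  assumes "A ** B = mat 1"
  shows "matrix_inv A = B"
proof -
  have BA: "B ** A = mat 1"
    using assms by (rule matrix_left_right_inverse[THEN iffD1])
  then have "A ** matrix_inv A = mat 1"
    unfolding matrix_inv_def using assms
      someI[of "\<lambda>A'. A ** A' = mat 1 \<and> A' ** A = mat 1" B] by simp
  then show ?thesis
    by (metis BA matrix_mul_assoc matrix_mul_lid matrix_mul_rid)
qed

text \<open>Gram-Schmidt for the inner product \<open>v \<bullet> (S *v w)\<close>, one index at a
  time.\<close>

lemma pos_def_orthonormal_family:
  fixes S :: "real^'n^'n" and A :: "'n set"
  assumes S: "pos_def_matrix S"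
  shows "\<exists>b. \<forall>i\<in>A. \<forall>j\<in>A. b i \<bullet> (S *v b j) = (if i = j then 1 else 0)"
proof (induction A rule: finite_induct[OF finite])
  case (2 k A)
  then obtain b where b: "\<And>i j. i \<in> A \<Longrightarrow> j \<in> A \<Longrightarrow> b i \<bullet> (S *v b j) = (if i = j then 1 else 0)"
    by blast
  have sym: "v \<bullet> (S *v w) = w \<bullet> (S *v v)" for v w
    using S by (metis dot_lmul_matrix inner_commute pos_def_matrix_def transpose_matrix_vector)
  \<comment> \<open>Fewer than \<open>CARD('n)\<close> vectors \<open>S *v b i\<close> cannot span
    the space. A nonzero vector orthogonal to them in the Euclidean sense is orthogonal to every
    \<open>b i\<close> for the form of \<open>S\<close>; it only remains to normalize it.\<close>
  have "dim ((\<lambda>i. S *v b i) ` A) \<le> card A"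
    by (meson card_image_le dim_le_card' finite le_trans finite_imageI)
  also have "card A < CARD('n)"
    using 2 by (metis UNIV_I card_subset_eq finite linorder_neqE_nat card_mono not_le subset_UNIV)
  finally have "dim ((\<lambda>i. S *v b i) ` A) < DIM(real^'n)"
    by simp
  then obtain v where v: "v \<noteq> 0" "\<And>y. y \<in> span ((\<lambda>i. S *v b i) ` A) \<Longrightarrow> orthogonal v y"
    using orthogonal_to_subspace_exists by blast
  have v0: "v \<bullet> (S *v b i) = 0" if "i \<in> A" for i
    using v(2)[of "S *v b i"] that by (simp add: orthogonal_def span_base)
  define q where "q = v \<bullet> (S *v v)"
  have "q > 0"
    using S v(1) by (simp add: q_def pos_def_matrix_def)
  define w where "w = (1 / sqrt q) *\<^sub>R v"
  have w0: "w \<bullet> (S *v b i) = 0" "b i \<bullet> (S *v w) = 0" if "i \<in> A" for i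
    using v0[OF that] sym[of w "b i"] by (auto simp: w_def)
  have w1: "w \<bullet> (S *v w) = 1"
    using \<open>q > 0\<close> by (simp add: w_def matrix_vector_mult_scaleR flip: q_def)
  show ?case
    using 2(2) b w0 w1 by (intro exI[of _ "b(k := w)"]) auto
qed auto

lemma pos_def_factorization:
  fixes S :: "real^'n^'n"
  assumes "pos_def_matrix S"
  obtains B :: "real^'n^'n" where "transpose B ** S ** B = mat 1"
proof -
  obtain b :: "'n \<Rightarrow> real^'n" where b: "\<And>i j. b i \<bullet> (S *v b j) = (if i = j then 1 else 0)"
    using pos_def_orthonormal_family[OF assms, of UNIV] by auto
  \<comment> \<open>With the orthonormal family as columns, the entries of
    \<open>transpose B ** S ** B\<close> are the pairings of its members.\<close>
  define B :: "real^'n^'n" where "B = (\<chi> i j. b j $ i)"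
  have "(transpose B ** S ** B) $ i $ j = b i \<bullet> (S *v b j)" for i j
    unfolding matrix_mul_assoc[symmetric]
    by (simp add: B_def transpose_def matrix_matrix_mult_def matrix_vector_mult_def inner_vec_def)
  then have "transpose B ** S ** B = mat 1"
    by (simp add: vec_eq_iff b mat_def)
  then show thesis
    by (rule that)
qed

text \<open>The coordinates \<open>B *v (x - \<mu>)\<close> are white: in them the form is the
  squared Euclidean norm. If \<open>C\<close> is the matrix from
  \<open>pos_def_factorization\<close>, then \<open>matrix_inv S = C ** transpose C\<close>, and the
  witnesses are \<open>A = S ** C\<close> and \<open>B = transpose C\<close>.\<close>

lemma mahalanobis_sq_factorization:
  fixes S :: "real^'n^'n"
  assumes "pos_def_matrix S"
  obtains A B :: "real^'n^'n" where "A ** B = mat 1" "B ** A = mat 1" "\<bar>det A\<bar> = sqrt (det S)"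
    "det S > 0" "\<And>\<mu> x. mahalanobis_sq \<mu> S x = (norm (B *v (x - \<mu>)))\<^sup>2"
proof -
  obtain B :: "real^'n^'n" where B: "transpose B ** S ** B = mat 1"
    using pos_def_factorization[OF assms] .
  have 1: "transpose B ** (S ** B) = mat 1"
    using B by (simp add: matrix_mul_assoc)
  then have 2: "(S ** B) ** transpose B = mat 1"
    by (rule matrix_left_right_inverse[THEN iffD1])
  have "det (transpose B ** S ** B) = 1"
    using B by (simp add: det_I)
  then have d: "(det B)\<^sup>2 * det S = 1"
    by (simp add: det_mul det_transpose power2_eq_square mult_ac)
  then have pos: "det S > 0"
    by (metis zero_less_mult_pos zero_less_one zero_less_power2 mult_zero_left zero_neq_one zero_power2)
  have "(det (S ** B))\<^sup>2 = det S"
    using d by (simp add: det_mul power_mult_distrib) (simp add: power2_eq_square mult_ac)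
  then have "\<bar>det (S ** B)\<bar> = sqrt (det S)"
    by (metis real_sqrt_abs)
  moreover have "matrix_inv S = B ** transpose B"
    using 2 by (intro matrix_inv_unique) (simp add: matrix_mul_assoc)
  then have "mahalanobis_sq \<mu> S x = (norm (transpose B *v (x - \<mu>)))\<^sup>2" for \<mu> x
    by (simp add: mahalanobis_sq_def power2_norm_eq_inner
        dot_lmul_matrix[symmetric] matrix_vector_mul_assoc[symmetric])
  ultimately show thesis
    using that 1 2 pos by blast
qed

lemma continuous_on_mahalanobis_sq: "continuous_on A (mahalanobis_sq \<mu> S)"
proof -
  have "continuous_on A (\<lambda>x. matrix_inv S *v (x - \<mu>))"
    using linear_continuous_on_compose[of A "\<lambda>x. x - \<mu>" "(*v) (matrix_inv S)"]
    by (simp add: continuous_on_diff)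
  then show ?thesis
    unfolding mahalanobis_sq_def[abs_def] by (intro continuous_intros)
qed

text \<open>The ellipsoid is the image of the ball of radius \<open>sqrt t\<close> under
  \<open>A\<close> followed by a translation, so the volume of the ball is multiplied by
  \<open>\<bar>det A\<bar> = sqrt (det S)\<close>.\<close>

lemma emeasure_mahalanobis_ellipsoid:
  fixes S :: "real^'n^'n"
  assumes S: "pos_def_matrix S" and t: "t \<ge> 0"
  shows "emeasure lborel {x. mahalanobis_sq \<mu> S x \<le> t} =
    ennreal (sqrt (det S) * unit_ball_vol (real CARD('n)) * t powr (real CARD('n) / 2))"
proof -
  obtain A B where AB: "A ** B = mat 1" "B ** A = mat 1" "\<bar>det A\<bar> = sqrt (det S)"
    and Q: "\<And>\<mu> x. mahalanobis_sq \<mu> S x = (norm (B *v (x - \<mu>)))\<^sup>2"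
    using mahalanobis_sq_factorization[OF S] by metis
  let ?E = "{x. mahalanobis_sq \<mu> S x \<le> t}"
  have "x \<in> (+) \<mu> ` ((*v) A) ` cball 0 (sqrt t)" if "norm (B *v (x - \<mu>)) \<le> sqrt t" for x
    using that AB by (intro image_eqI[of _ _ "x - \<mu>"] image_eqI[of _ _ "B *v (x - \<mu>)"])
      (auto simp: matrix_vector_mul_assoc)
  moreover have "(norm v)\<^sup>2 \<le> t \<longleftrightarrow> norm v \<le> sqrt t" for v :: "real^'n"
    using real_sqrt_le_iff[of "(norm v)\<^sup>2" t] by simp
  ultimately have E: "?E = (+) \<mu> ` ((*v) A) ` cball 0 (sqrt t)"
    by (auto simp: Q matrix_vector_mul_assoc AB)
  have meas: "(*v) A ` cball 0 (sqrt t) \<in> lmeasurable"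
    and "measure lebesgue ((*v) A ` cball 0 (sqrt t)) = \<bar>det A\<bar> * measure lebesgue (cball (0::real^'n) (sqrt t))"
    using lmeasurable_linear_image_det[of "(*v) A" "cball 0 (sqrt t)"] by auto
  then have *: "measure lebesgue ?E = sqrt (det S) * measure lborel (cball (0::real^'n) (sqrt t))"
    unfolding E measure_translation by (simp add: AB)
  have "sqrt t ^ CARD('n) = t powr (real CARD('n) / 2)"
  proof (cases "t = 0")
    case False
    then have "t powr (real CARD('n) / 2) = (t powr (1 / 2)) powr real CARD('n)"
      by (simp add: powr_powr)
    also have "\<dots> = sqrt t ^ CARD('n)"
      using t False by (simp add: powr_half_sqrt powr_realpow)
    finally show ?thesis
      by simp
  qed simp
  then have "measure lborel (cball (0::real^'n) (sqrt t)) =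
      unit_ball_vol (real CARD('n)) * t powr (real CARD('n) / 2)"
    using t by (simp add: content_cball)
  with * have eq: "measure lebesgue ?E =
      sqrt (det S) * unit_ball_vol (real CARD('n)) * t powr (real CARD('n) / 2)"
    by simp
  \<comment> \<open>The volume was computed in \<open>lebesgue\<close>; being closed, the ellipsoid
    is a Borel set, on which \<open>lborel\<close> takes the same value.\<close>
  have "closed ?E"
    by (intro closed_Collect_le continuous_on_mahalanobis_sq continuous_on_const)
  then have "?E \<in> sets lborel"
    using borel_closed[of ?E] by simp
  then have "emeasure lborel ?E = emeasure lebesgue ?E"
    by simp
  also have "\<dots> = ennreal (measure lebesgue ?E)"
    unfolding E by (intro emeasure_eq_measure2 measurable_translation meas)
  finally show ?thesis
    by (simp only: eq)
qed

subsection \<open>Distribution of the transformed distance\<close>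

lemma psi_strict_mono:
  assumes "d > 0" "0 \<le> s" "s < t"
  shows "psi d a s < psi d a t"
proof -
  have "s powr (real d / 2) < t powr (real d / 2)"
    using assms by (intro powr_less_mono2) auto
  then show ?thesis
    using assms unfolding psi_def by (auto intro!: powr_less_mono2 add_nonneg_nonneg)
qed

text \<open>\<open>q\<close> solves
  \<open>a powr (d / 2) + q powr (d / 2) = (y + a) powr (d / 2)\<close>. The first claim later makes
  the volume of an ellipsoid an explicit function of \<open>y\<close>.\<close>

lemma psi_root:
  assumes d: "d > 0" and a: "a > 0" and y: "y \<ge> 0"
  defines "q \<equiv> ((y + a) powr (real d / 2) - a powr (real d / 2)) powr (2 / real d)"
  shows "q powr (real d / 2) = (y + a) powr (real d / 2) - a powr (real d / 2)"
    and "psi d a q = y"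
proof -
  have "a powr (real d / 2) \<le> (y + a) powr (real d / 2)"
    using assms by (intro powr_mono2) auto
  then show *: "q powr (real d / 2) = (y + a) powr (real d / 2) - a powr (real d / 2)"
    using d by (simp add: q_def powr_powr)
  show "psi d a q = y"
    using assms(1-3) by (simp add: psi_def * powr_powr)
qed

lemma psi_inv_eq:
  assumes "d > 0" "a > 0" "y \<ge> 0"
  shows "psi_inv d a y = ((y + a) powr (real d / 2) - a powr (real d / 2)) powr (2 / real d)"
proof -
  have "inj_on (psi d a) {0..}"
    using psi_strict_mono[OF assms(1)]
    by (intro linorder_inj_onI) (auto simp: less_le)
  then show ?thesis
    unfolding psi_inv_def using psi_root(2)[OF assms] by (intro inv_into_f_eq) auto
qed

lemma psi_inv_nonneg:
  assumes "d > 0" "a > 0" "y \<ge> 0"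
  shows "psi_inv d a y \<ge> 0"
  using psi_inv_eq[OF assms] by simp

lemma psi_psi_inv:
  assumes "d > 0" "a > 0" "y \<ge> 0"
  shows "psi d a (psi_inv d a y) = y"
  using psi_inv_eq[OF assms] psi_root(2)[OF assms] by simp

lemma psi_zero: "d > 0 \<Longrightarrow> a > 0 \<Longrightarrow> psi d a 0 = 0"
  by (simp add: psi_def powr_powr)

lemma psi_nonneg: "d > 0 \<Longrightarrow> a > 0 \<Longrightarrow> t \<ge> 0 \<Longrightarrow> psi d a t \<ge> 0"
  using psi_strict_mono[of d 0 t a] psi_zero[of d a] by (cases "t = 0") auto

text \<open>Turns sublevel sets of the transformed distance into ellipsoids.\<close>

lemma psi_le_iff:
  assumes "d > 0" "a > 0" "t \<ge> 0" "y \<ge> 0"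
  shows "psi d a t \<le> y \<longleftrightarrow> t \<le> psi_inv d a y"
  using psi_strict_mono[of d t "psi_inv d a y" a] psi_strict_mono[of d "psi_inv d a y" t a]
    psi_psi_inv[of d a y] psi_inv_nonneg[of d a y] assms
  by (metis less_eq_real_def linorder_not_less)

lemma psi_inv_psi:
  assumes "d > 0" "a > 0" "t \<ge> 0"
  shows "psi_inv d a (psi d a t) = t"
proof -
  have "psi d a t \<ge> 0"
    using assms by (rule psi_nonneg)
  then have "psi d a (psi_inv d a (psi d a t)) = psi d a t" "psi_inv d a (psi d a t) \<ge> 0"
    using assms by (auto intro: psi_psi_inv psi_inv_nonneg)
  then show ?thesis
    using psi_strict_mono[of d t "psi_inv d a (psi d a t)" a]
      psi_strict_mono[of d "psi_inv d a (psi d a t)" t a] assms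
    by (metis less_irrefl linorder_neqE_linordered_idom)
qed

text \<open>The chain rule gives
  \<open>(a powr p + t powr p) powr (1 / p - 1) * t powr (p - 1)\<close> with
  \<open>p = d / 2\<close>. The first factor is rewritten as a power of
  \<open>psi d a t + a\<close>, so that it becomes a power of \<open>y + a\<close> at
  \<open>y = psi d a t\<close>.\<close>

lemma deriv_psi:
  assumes "d > 0" "a > 0" "t > 0"
  shows "deriv (psi d a) t = (psi d a t + a) powr (1 - real d / 2) * t powr (real d / 2 - 1)"
proof -
  define p where "p = real d / 2"
  have p: "p > 0" "2 / real d = 1 / p"
    using assms by (auto simp: p_def)
  have pos: "a powr p + t powr p > 0"
    using assms by (intro add_pos_pos) auto
  have "(psi d a has_real_derivative
      (1 / p) * (a powr p + t powr p) powr (1 / p - 1) * (p * t powr (p - 1))) (at t)"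
    unfolding psi_def[abs_def] p_def[symmetric] p(2)
    using pos \<open>t > 0\<close> by (auto intro!: derivative_eq_intros simp: powr_diff field_simps)
  then have "deriv (psi d a) t = (a powr p + t powr p) powr (1 / p - 1) * t powr (p - 1)"
    using p by (simp add: DERIV_imp_deriv)
  also have "(a powr p + t powr p) powr (1 / p - 1) = ((a powr p + t powr p) powr (1 / p)) powr (1 - p)"
    using p by (simp add: powr_powr field_simps)
  finally have "deriv (psi d a) t =
      ((a powr p + t powr p) powr (1 / p)) powr (1 - p) * t powr (p - 1)" .
  moreover have "psi d a t + a = (a powr p + t powr p) powr (1 / p)"
    by (simp add: psi_def p(2) flip: p_def)
  ultimately show ?thesis
    by (simp add: p_def)
qed

lemma deriv_psi_pos:
  assumes "d > 0" "a > 0" "t > 0"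
  shows "deriv (psi d a) t > 0"
proof -
  have "psi d a t + a > 0"
    using psi_nonneg[of d a t] assms by linarith
  then show ?thesis
    using assms by (simp add: deriv_psi)
qed

text \<open>The power of \<open>t\<close> in \<open>z_fun\<close> cancels against the one in the
  derivative of \<open>psi\<close>, leaving only a power of \<open>y + a\<close>.\<close>

lemma rho_eq:
  assumes d: "d > 0" and a: "a > 0" and y: "y > 0"
  shows "rho d a g y = (y + a) powr (real d / 2 - 1) * g (psi_inv d a y)"
proof -
  define t where "t = psi_inv d a y"
  have yt: "psi d a t = y" and "t \<ge> 0"
    using assms by (auto simp: t_def psi_psi_inv psi_inv_nonneg)
  then have t: "t > 0"
    using psi_zero[OF d a] y by (cases "t = 0") auto
  have "t powr ((real d - 2) / 2) / deriv (psi d a) t = (y + a) powr (real d / 2 - 1)"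
  proof -
    have "(real d - 2) / 2 = real d / 2 - 1"
      by simp
    moreover have "1 - real d / 2 = - (real d / 2 - 1)"
      by simp
    ultimately show ?thesis
      unfolding deriv_psi[OF d a t] yt using t y a
      by (simp only: powr_minus) (simp add: field_simps)
  qed
  then show ?thesis
    by (simp add: rho_def z_fun_def t_def)
      (metis (no_types, lifting) mult.commute times_divide_eq_left)
qed

text \<open>Follows from \<open>Gamma (p + 1) = p * Gamma p\<close> at \<open>p = d / 2\<close>.
  This is half the surface area of the unit sphere, and the constant that appears on differentiating
  \<open>unit_ball_vol d * t powr (d / 2)\<close>.\<close>

lemma s_const_eq:
  assumes "d > 0"
  shows "s_const d = real d / 2 * unit_ball_vol (real d)"
proof -
  have "real d / 2 \<notin> \<int>\<^sub>\<le>\<^sub>0"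
    using assms nonpos_Ints_nonpos[of "real d / 2"] by auto
  then have "Gamma (real d / 2 + 1) = real d / 2 * Gamma (real d / 2)"
    by (rule Gamma_plus1)
  then show ?thesis
    unfolding s_const_def unit_ball_vol_def by (simp only:) (use assms in simp)
qed

lemma s_const_pos: "d > 0 \<Longrightarrow> s_const d > 0"
  by (simp add: s_const_eq)

section \<open>Push-forward of Lebesgue measure and integrals against the density\<close>

lemma mahalanobis_sq_nonneg:
  assumes "pos_def_matrix S"
  shows "mahalanobis_sq \<mu> S x \<ge> 0"
  using mahalanobis_sq_factorization[OF assms] by (metis zero_le_power2)

lemma mahalanobis_sq_measurable [measurable]: "mahalanobis_sq \<mu> S \<in> borel_measurable borel"
  by (intro borel_measurable_continuous_onI continuous_on_mahalanobis_sq)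

lemma psi_measurable [measurable]: "psi d a \<in> borel_measurable borel"
  unfolding psi_def[abs_def] by measurable

text \<open>The push-forward of Lebesgue measure gives \<open>{..y}\<close> the volume of an
  ellipsoid, which for \<open>y \<ge> 0\<close> equals \<open>F y - F 0\<close>; differentiating
  \<open>F\<close> gives the density. The function \<open>g\<close> enters only afterwards.\<close>

lemma distr_psi_mahalanobis:
  fixes S :: "real^'n^'n"
  defines "d \<equiv> CARD('n)"
  assumes S: "pos_def_matrix S" and a: "a > 0"
  shows "distr lborel borel (\<lambda>x. psi d a (mahalanobis_sq \<mu> S x)) =
    density lborel (\<lambda>y. ennreal (indicator {0<..} y *
      (sqrt (det S) * s_const d * (y + a) powr (real d / 2 - 1))))"
    (is "?M = density lborel (\<lambda>y. ennreal (?f y))")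
proof -
  have d: "d > 0"
    by (simp add: d_def)
  define c where "c = sqrt (det S) * unit_ball_vol (real d)"
  have "det S > 0"
    using mahalanobis_sq_factorization[OF S] by metis
  then have c: "c > 0"
    by (simp add: c_def)
  define F where "F y = c * (y + a) powr (real d / 2)" for y
  have F: "(F has_real_derivative sqrt (det S) * s_const d * (y + a) powr (real d / 2 - 1)) (at y)"
    if "y \<ge> 0" for y
    unfolding F_def[abs_def] s_const_eq[OF d] c_def using that a
    by (auto intro!: derivative_eq_intros simp: powr_diff field_simps)
  have eq: "emeasure ?M {..y} = emeasure (density lborel (\<lambda>y. ennreal (?f y))) {..y}" for y
  proof (cases "y \<ge> 0")
    case False
    then have "\<not> psi d a (mahalanobis_sq \<mu> S x) \<le> y" for x
      using psi_nonneg[OF d a mahalanobis_sq_nonneg[OF S, of \<mu> x]] by linarith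
    then have "{x. psi d a (mahalanobis_sq \<mu> S x) \<le> y} = {}"
      by blast
    moreover have "(\<integral>\<^sup>+u. ennreal (?f u) * indicator {..y} u \<partial>lborel) = (\<integral>\<^sup>+u. 0 \<partial>(lborel :: real measure))"
      using False by (intro nn_integral_cong) (auto simp: indicator_def)
    ultimately show ?thesis
      by (simp add: emeasure_distr emeasure_density vimage_def)
  next
    case True
    have "{x. psi d a (mahalanobis_sq \<mu> S x) \<le> y} = {x. mahalanobis_sq \<mu> S x \<le> psi_inv d a y}"
      using psi_le_iff[OF d a mahalanobis_sq_nonneg[OF S] True] by simp
    then have "emeasure ?M {..y} = emeasure lborel {x. mahalanobis_sq \<mu> S x \<le> psi_inv d a y}"
      by (simp add: emeasure_distr vimage_def)
    also have "\<dots> = ennreal (c * psi_inv d a y powr (real d / 2))"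
      using emeasure_mahalanobis_ellipsoid[OF S psi_inv_nonneg[OF d a True]]
      by (simp add: c_def d_def)
    also have "c * psi_inv d a y powr (real d / 2) = F y - F 0"
      unfolding psi_inv_eq[OF d a True] psi_root(1)[OF d a True] F_def by (simp add: algebra_simps)
    also have "ennreal (F y - F 0) = (\<integral>\<^sup>+u. ennreal (sqrt (det S) * s_const d * (u + a) powr (real d / 2 - 1)) *
        indicator {0..y} u \<partial>lborel)"
      using True F \<open>det S > 0\<close> s_const_pos[OF d] by (intro nn_integral_FTC_Icc[symmetric]) auto
    also have "\<dots> = (\<integral>\<^sup>+u. ennreal (?f u) * indicator {..y} u \<partial>lborel)"
      \<comment> \<open>The two integrands differ at most at the point \<open>0\<close>, which
        \<open>{0..y}\<close> contains and \<open>{0<..}\<close> does not.\<close>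
      using AE_lborel_singleton[of "0::real"]
      by (intro nn_integral_cong_AE) (auto elim!: eventually_mono simp: indicator_def)
    finally show ?thesis
      by (simp add: emeasure_density)
  qed
  show ?thesis
  \<comment> \<open>Both measures are infinite, so agreement on half-lines is combined with an
    exhaustion by half-lines of finite measure.\<close>
  proof (rule measure_eqI_generator_eq[where E = "range atMost" and \<Omega> = UNIV and A = "\<lambda>n. {..real n}"])
    show "Int_stable (range (atMost :: real \<Rightarrow> real set))"
      by (auto simp: Int_stable_def)
    show "emeasure ?M {..real i} \<noteq> \<infinity>" for i
    proof -
      have "{x. psi d a (mahalanobis_sq \<mu> S x) \<le> real i} = {x. mahalanobis_sq \<mu> S x \<le> psi_inv d a (real i)}"
        using psi_le_iff[OF d a mahalanobis_sq_nonneg[OF S]] by simp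
      then show ?thesis
        using emeasure_mahalanobis_ellipsoid[OF S psi_inv_nonneg[OF d a], of "real i"]
        by (simp add: emeasure_distr vimage_def)
    qed
    show "(\<Union>i. {..real i}) = (UNIV :: real set)"
      using real_arch_simple by auto
    show "emeasure ?M X = emeasure (density lborel (\<lambda>y. ennreal (?f y))) X" if "X \<in> range atMost" for X
      using that eq by auto
    have "sets (borel :: real measure) = sigma_sets UNIV (range atMost)"
      by (subst borel_eq_atMost) (simp add: sets_measure_of)
    then show "sets ?M = sigma_sets UNIV (range atMost)"
      "sets (density lborel (\<lambda>y. ennreal (?f y))) = sigma_sets UNIV (range atMost)"
      by simp_all
  qed auto
qed

text \<open>Measurability is assumed of the density on the whole space, not of \<open>g\<close>.
  Evaluating the density along a ray from \<mu>, parametrized so that the squared distance is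
  \<open>psi_inv d a y\<close>, recovers \<open>g\<close> up to a constant factor.\<close>

lemma radial_measurable:
  fixes S :: "real^'n^'n"
  defines "d \<equiv> CARD('n)"
  assumes S: "pos_def_matrix S" and a: "a > 0"
    and f: "elliptical_density \<mu> S g \<in> borel_measurable borel"
  shows "(\<lambda>y. indicator {0..} y * g (psi_inv d a y)) \<in> borel_measurable borel"
proof -
  have d: "d > 0"
    by (simp add: d_def)
  obtain A B :: "real^'n^'n" where AB: "B ** A = mat 1" "det S > 0"
    and Q: "\<And>\<mu> x. mahalanobis_sq \<mu> S x = (norm (B *v (x - \<mu>)))\<^sup>2"
    using mahalanobis_sq_factorization[OF S] by metis
  \<comment> \<open>Any unit vector serves; \<open>undefined\<close> merely names some
    index.\<close>
  define e :: "real^'n" where "e = axis undefined 1"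
  define q where "q y = ((y + a) powr (real d / 2) - a powr (real d / 2)) powr (2 / real d)" for y
  define v where "v y = \<mu> + sqrt (q y) *\<^sub>R (A *v e)" for y
  have "mahalanobis_sq \<mu> S (v y) = q y" for y
  proof -
    have "B *v (v y - \<mu>) = sqrt (q y) *\<^sub>R e"
      by (simp add: v_def matrix_vector_mult_scaleR matrix_vector_mul_assoc AB)
    then show ?thesis
      by (simp add: Q e_def q_def)
  qed
  then have "g (q y) = sqrt (det S) * elliptical_density \<mu> S g (v y)" for y
    using AB by (simp add: elliptical_density_def powr_half_sqrt powr_minus field_simps)
  moreover have "(\<lambda>y. elliptical_density \<mu> S g (v y)) \<in> borel_measurable borel"
    using f unfolding v_def q_def by measurable
  ultimately have "(\<lambda>y. indicator {0..} y * g (q y)) \<in> borel_measurable borel"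
    by simp
  also have "(\<lambda>y. indicator {0..} y * g (q y)) = (\<lambda>y. indicator {0..} y * g (psi_inv d a y))"
    by (auto simp: fun_eq_iff indicator_def q_def psi_inv_eq[OF d a])
  finally show ?thesis .
qed

text \<open>Since \<open>psi\<close> is injective on nonnegative distances, the integrand is a
  function of the transformed distance alone, and the integral moves to the push-forward. The powers
  of \<open>det S\<close> cancel.\<close>

lemma integral_elliptical_density:
  fixes S :: "real^'n^'n" and F :: "real \<Rightarrow> real"
  defines "d \<equiv> CARD('n)"
  assumes S: "pos_def_matrix S" and a: "a > 0"
    and f: "elliptical_density \<mu> S g \<in> borel_measurable borel"
    and F[measurable]: "F \<in> borel_measurable borel"
  shows "(\<integral>x. elliptical_density \<mu> S g x * F (psi d a (mahalanobis_sq \<mu> S x)) \<partial>lborel) =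
    s_const d * (\<integral>y. indicator {0<..} y * (rho d a g y * F y) \<partial>lborel)"
proof -
  have d: "d > 0"
    by (simp add: d_def)
  have S0: "det S > 0"
    using mahalanobis_sq_factorization[OF S] by metis
  have gm[measurable]: "(\<lambda>y. indicator {0..} y * g (psi_inv d a y)) \<in> borel_measurable borel"
    unfolding d_def by (rule radial_measurable[OF S a f])
  \<comment> \<open>The indicator makes \<open>G\<close> Borel on the whole line and changes nothing
    at transformed distances, which are nonnegative.\<close>
  define G where "G y = det S powr (- 1 / 2) * (indicator {0..} y * g (psi_inv d a y)) * F y" for y
  have G[measurable]: "G \<in> borel_measurable borel"
    unfolding G_def by measurable
  have "elliptical_density \<mu> S g x * F (psi d a (mahalanobis_sq \<mu> S x)) =
      G (psi d a (mahalanobis_sq \<mu> S x))" for x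
    using mahalanobis_sq_nonneg[OF S, of \<mu> x]
    by (simp add: G_def elliptical_density_def psi_inv_psi[OF d a] psi_nonneg[OF d a])
  then have "(\<integral>x. elliptical_density \<mu> S g x * F (psi d a (mahalanobis_sq \<mu> S x)) \<partial>lborel) =
      (\<integral>y. G y \<partial>distr lborel borel (\<lambda>x. psi d a (mahalanobis_sq \<mu> S x)))"
    by (simp add: integral_distr)
  also have "\<dots> = (\<integral>y. indicator {0<..} y *
      (sqrt (det S) * s_const d * (y + a) powr (real d / 2 - 1)) * G y \<partial>lborel)"
    unfolding d_def distr_psi_mahalanobis[OF S a] using S0 s_const_pos[OF d]
    by (subst integral_density) (auto simp: d_def)
  also have "\<dots> = (\<integral>y. s_const d * (indicator {0<..} y * (rho d a g y * F y)) \<partial>lborel)"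
    using S0 by (intro Bochner_Integration.integral_cong)
      (auto simp: G_def indicator_def rho_eq[OF d a] powr_minus powr_half_sqrt field_simps)
  finally show ?thesis
    by simp
qed

subsection \<open>Kernel smoothing\<close>

text \<open>Lagrange remainder, with the derivatives bounded on a compact ball. The order
  \<open>m\<close> is left free: the mean of the estimator calls for order 3, the second moment only
  for order 1.\<close>

lemma cont_diff_near_taylor:
  assumes r: "cont_diff_near k r x" and k: "k > 0"
  obtains \<delta> C where "\<delta> > 0" "C \<ge> 0" "continuous_on (cball x \<delta>) r"
    "\<And>u m. \<bar>u\<bar> \<le> \<delta> \<Longrightarrow> 0 < m \<Longrightarrow> m \<le> k \<Longrightarrow>
      \<bar>r (x + u) - (\<Sum>j<m. (deriv ^^ j) r x / fact j * u ^ j)\<bar> \<le> C * \<bar>u\<bar> ^ m"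
proof -
  obtain U where U: "open U" "x \<in> U"
    and diff: "\<And>j y. j < k \<Longrightarrow> y \<in> U \<Longrightarrow> (deriv ^^ j) r differentiable at y"
    and cont: "continuous_on U ((deriv ^^ k) r)"
    using r unfolding cont_diff_near_def by blast
  obtain \<delta> where \<delta>: "\<delta> > 0" "cball x \<delta> \<subseteq> U"
    using U open_contains_cball by metis
  have DERIV: "((deriv ^^ j) r has_real_derivative (deriv ^^ Suc j) r y) (at y)"
    if "j < k" "y \<in> cball x \<delta>" for j y
    using diff[of j y] that \<delta> by (auto simp: DERIV_deriv_iff_real_differentiable)
  have cj: "continuous_on (cball x \<delta>) ((deriv ^^ j) r)" if "j \<le> k" for j
  proof (cases "j = k")
    case True
    then show ?thesis
      using cont \<delta> continuous_on_subset by blast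
  next
    case False
    then have "j < k"
      using that by simp
    then have "isCont ((deriv ^^ j) r) y" if "y \<in> cball x \<delta>" for y
      using DERIV_isCont[OF DERIV] that by blast
    then show ?thesis
      using continuous_at_imp_continuous_on by blast
  qed
  have "\<exists>B\<ge>0. \<forall>y\<in>cball x \<delta>. \<bar>(deriv ^^ j) r y\<bar> \<le> B" if "j \<le> k" for j
  proof -
    have "compact ((deriv ^^ j) r ` cball x \<delta>)"
      using cj[OF that] by (intro compact_continuous_image) auto
    then obtain B where "\<forall>y\<in>cball x \<delta>. norm ((deriv ^^ j) r y) \<le> B"
      using compact_imp_bounded bounded_iff by (metis (mono_tags, lifting) imageI)
    then show ?thesis
      by (intro exI[of _ "max 0 B"]) auto
  qed
  then obtain B where B: "\<And>j. j \<le> k \<Longrightarrow> B j \<ge> 0"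
    "\<And>j y. j \<le> k \<Longrightarrow> y \<in> cball x \<delta> \<Longrightarrow> \<bar>(deriv ^^ j) r y\<bar> \<le> B j"
    by metis
  \<comment> \<open>Summing the bounds gives a single constant for all orders.\<close>
  define C where "C = (\<Sum>j\<le>k. B j)"
  have BC: "B j \<le> C" if "j \<le> k" for j
    unfolding C_def using that B(1) by (intro member_le_sum) auto
  have "\<bar>r (x + u) - (\<Sum>j<m. (deriv ^^ j) r x / fact j * u ^ j)\<bar> \<le> C * \<bar>u\<bar> ^ m"
    if u: "\<bar>u\<bar> \<le> \<delta>" and m: "0 < m" "m \<le> k" for u m
  \<comment> \<open>Taylor's theorem requires a point different from the centre. At
    \<open>u = 0\<close> only the term \<open>j = 0\<close> survives, as
    \<open>0 ^ 0 = 1\<close>.\<close>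
  proof (cases "u = 0")
    case True
    have "(\<Sum>j<m. (deriv ^^ j) r x / fact j * 0 ^ j) = r x"
      using m by (subst sum.remove[of _ 0]) (auto intro!: sum.neutral)
    then show ?thesis
      using True m by (simp add: zero_power)
  next
    case False
    have "\<exists>t. (if x + u < x then x + u < t \<and> t < x else x < t \<and> t < x + u) \<and>
        r (x + u) = (\<Sum>j<m. ((deriv ^^ j) r x / fact j) * (x + u - x) ^ j) +
          ((deriv ^^ m) r t / fact m) * (x + u - x) ^ m"
    proof (rule Taylor[where a = "x - \<delta>" and b = "x + \<delta>"])
      show "\<forall>j t. j < m \<and> x - \<delta> \<le> t \<and> t \<le> x + \<delta> \<longrightarrow>
          ((deriv ^^ j) r has_real_derivative (deriv ^^ Suc j) r t) (at t)"
        using DERIV m by (auto simp: dist_real_def abs_le_iff)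
    qed (use m u False \<delta> in auto)
    then obtain t where t0: "if x + u < x then x + u < t \<and> t < x else x < t \<and> t < x + u"
      and eq0: "r (x + u) = (\<Sum>j<m. ((deriv ^^ j) r x / fact j) * (x + u - x) ^ j) +
          ((deriv ^^ m) r t / fact m) * (x + u - x) ^ m"
      by blast
    have t: "t \<in> cball x \<delta>"
      using t0 u by (auto simp: dist_real_def split: if_splits)
    have eq: "r (x + u) - (\<Sum>j<m. (deriv ^^ j) r x / fact j * u ^ j) = (deriv ^^ m) r t / fact m * u ^ m"
      using eq0 by simp
    have "\<bar>(deriv ^^ m) r t\<bar> / fact m \<le> C / 1"
      using B(2)[OF m(2) t] BC[OF m(2)] by (intro frac_le) (auto simp: fact_ge_1)
    then show ?thesis
      unfolding eq abs_mult abs_divide power_abs by (intro mult_right_mono) auto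
  qed
  moreover have "C \<ge> 0"
    unfolding C_def using B(1) by (intro sum_nonneg) auto
  ultimately show thesis
    using that \<delta>(1) cj[of 0] by auto
qed

text \<open>Dominated by \<open>B\<close> times the absolute value of \<open>f\<close> on the
  compact interval \<open>{-R..R}\<close>.\<close>

lemma integrable_bounded_support_mult:
  fixes L f :: "real \<Rightarrow> real"
  assumes L[measurable]: "L \<in> borel_measurable borel" and L_bound: "\<And>w. \<bar>L w\<bar> \<le> B"
    and L_supp: "\<And>w. \<bar>w\<bar> > R \<Longrightarrow> L w = 0"
    and f: "continuous_on {-R..R} f"
  shows "integrable lborel (\<lambda>w. L w * f w)"
proof -
  have B0: "B \<ge> 0"
    using L_bound[of 0] by linarith
  have "integrable lborel (\<lambda>w. indicator {-R..R} w *\<^sub>R f w)"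
    using borel_integrable_compact[OF _ f] by simp
  then have ind: "integrable lborel (\<lambda>w. B * (indicator {-R..R} w *\<^sub>R f w))"
    by simp
  have fm[measurable]: "(\<lambda>w. indicator {-R..R} w *\<^sub>R f w) \<in> borel_measurable borel"
    by (intro borel_measurable_continuous_on_indicator f) auto
  have "integrable lborel (\<lambda>w. L w * (indicator {-R..R} w *\<^sub>R f w))"
  proof (rule Bochner_Integration.integrable_bound[OF ind])
    show "(\<lambda>w. L w * (indicator {-R..R} w *\<^sub>R f w)) \<in> borel_measurable lborel"
      by measurable
  qed (use L_bound B0 in \<open>simp add: abs_mult mult_right_mono\<close>)
  also have "(\<lambda>w. L w * (indicator {-R..R} w *\<^sub>R f w)) = (\<lambda>w. L w * f w)"
  proof
    show "L w * (indicator {-R..R} w *\<^sub>R f w) = L w * f w" for w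
      using L_supp[of w] by (cases "\<bar>w\<bar> \<le> R") (auto simp: indicator_def)
  qed
  finally show ?thesis .
qed

text \<open>On the support \<open>\<bar>h * w\<bar> \<le> h * R \<le> \<delta>\<close>, so the
  integrands differ by at most \<open>B * C * (h * R) ^ m\<close> on an interval of length
  \<open>2 * R\<close>. The weight \<open>L\<close> will be \<open>K\<close> or its square.\<close>

lemma kernel_integral_remainder:
  fixes r P L :: "real \<Rightarrow> real"
  assumes L[measurable]: "L \<in> borel_measurable borel" and L_bound: "\<And>w. \<bar>L w\<bar> \<le> B"
    and L_supp: "\<And>w. \<bar>w\<bar> > R \<Longrightarrow> L w = 0"
    and R: "R > 0" and h: "h > 0" "h * R \<le> \<delta>"
    and r: "continuous_on (cball x \<delta>) r" and P: "continuous_on UNIV P"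
    and C: "\<And>u. \<bar>u\<bar> \<le> \<delta> \<Longrightarrow> \<bar>r (x + u) - P u\<bar> \<le> C * \<bar>u\<bar> ^ m"
  shows "\<bar>(\<integral>w. L w * r (x - h * w) \<partial>lborel) - (\<integral>w. L w * P (- (h * w)) \<partial>lborel)\<bar> \<le>
    2 * B * C * R ^ Suc m * h ^ m"
proof -
  have B0: "B \<ge> 0"
    using L_bound[of 0] by linarith
  have hw: "\<bar>- (h * w)\<bar> \<le> \<delta>" if "\<bar>w\<bar> \<le> R" for w
    using that h by (simp add: abs_mult) (meson less_eq_real_def mult_left_mono order_trans)
  have "continuous_on {-R..R} (\<lambda>w. r (x - h * w))"
    using hw by (intro continuous_on_compose2[OF r] continuous_intros) (auto simp: dist_real_def)
  moreover have "continuous_on {-R..R} (\<lambda>w. P (- (h * w)))"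
    by (intro continuous_on_compose2[OF P] continuous_intros) auto
  ultimately have int: "integrable lborel (\<lambda>w. L w * r (x - h * w))"
      "integrable lborel (\<lambda>w. L w * P (- (h * w)))"
    using integrable_bounded_support_mult[OF L L_bound L_supp] by blast+
  have bound: "\<bar>L w * r (x - h * w) - L w * P (- (h * w))\<bar> \<le>
      indicator {-R..R} w * (B * (C * (h * R) ^ m))" for w
  proof (cases "\<bar>w\<bar> \<le> R")
    case True
    have C0: "C \<ge> 0"
      using C[of "h * R"] h R by (smt (verit) mult_pos_pos zero_less_power zero_le_mult_iff)
    have "\<bar>r (x - h * w) - P (- (h * w))\<bar> \<le> C * \<bar>- (h * w)\<bar> ^ m"
      using C[OF hw[OF True]] by simp
    also have "\<dots> \<le> C * (h * R) ^ m"
      using C0 True h by (intro mult_left_mono power_mono) (auto simp: abs_mult)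
    finally have "\<bar>L w\<bar> * \<bar>r (x - h * w) - P (- (h * w))\<bar> \<le> B * (C * (h * R) ^ m)"
      using L_bound B0 by (intro mult_mono) auto
    then show ?thesis
      using True by (simp add: indicator_def abs_le_iff flip: right_diff_distrib abs_mult)
  next
    case False
    then show ?thesis
      using L_supp[of w] by (auto simp: indicator_def)
  qed
  have "\<bar>(\<integral>w. L w * r (x - h * w) \<partial>lborel) - (\<integral>w. L w * P (- (h * w)) \<partial>lborel)\<bar> =
      \<bar>\<integral>w. L w * r (x - h * w) - L w * P (- (h * w)) \<partial>lborel\<bar>"
    using int by simp
  also have "\<dots> \<le> (\<integral>w. indicator {-R..R} w * (B * (C * (h * R) ^ m)) \<partial>lborel)"
  proof (rule integral_abs_bound[THEN order_trans], rule integral_mono)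
    show "integrable lborel (\<lambda>w. indicator {-R..R} w * (B * (C * (h * R) ^ m)))"
      by (intro integrable_mult_left integrable_real_indicator) (auto simp: emeasure_lborel_Icc_eq)
  qed (use int bound in auto)
  also have "\<dots> = 2 * B * C * R ^ Suc m * h ^ m"
    using R by (simp add: power_mult_distrib)
  finally show ?thesis .
qed

lemma smoothing_kernelD:
  assumes "smoothing_kernel K"
  shows "K \<in> borel_measurable borel" "K (- w) = K w" "(LBINT w. K w) = 1"
    and "\<exists>B R. R > 0 \<and> (\<forall>w. \<bar>K w\<bar> \<le> B) \<and> (\<forall>w. \<bar>w\<bar> > R \<longrightarrow> K w = 0)"
proof -
  show "K \<in> borel_measurable borel" "K (- w) = K w" "(LBINT w. K w) = 1"
    using assms unfolding smoothing_kernel_def by auto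
  obtain B where B: "\<And>w. \<bar>K w\<bar> \<le> B"
    using assms unfolding smoothing_kernel_def bounded_iff by auto
  have "bounded {w. K w \<noteq> 0}"
    using assms unfolding smoothing_kernel_def
    by (meson bounded_closure_image compact_imp_bounded bounded_subset closure_subset)
  then obtain R where R: "R > 0" "\<And>w. K w \<noteq> 0 \<Longrightarrow> \<bar>w\<bar> \<le> R"
    unfolding bounded_pos by auto
  have "\<bar>w\<bar> > R \<longrightarrow> K w = 0" for w
    using R(2)[of w] by linarith
  then show "\<exists>B R. R > 0 \<and> (\<forall>w. \<bar>K w\<bar> \<le> B) \<and> (\<forall>w. \<bar>w\<bar> > R \<longrightarrow> K w = 0)"
    using B R(1) by blast
qed

text \<open>For \<open>y > 0\<close> the reflected argument exceeds \<open>R\<close>; for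
  \<open>y \<le> 0\<close> both arguments of \<open>K\<close> cannot matter, since the direct one
  exceeds \<open>R\<close> and the indicator vanishes. Hence reflection and boundary both drop
  out.\<close>

lemma reflected_kernel_integral:
  fixes K r :: "real \<Rightarrow> real"
  assumes supp: "\<And>w. \<bar>w\<bar> > R \<Longrightarrow> K w = 0"
    and h: "h > 0" "h * R < y0" and R: "R > 0" and k: "k > 0"
  shows "(\<integral>y. indicator {0<..} y * (r y * (K ((y0 - y) / h) + K ((y0 + y) / h)) ^ k) \<partial>lborel) =
    h * (\<integral>w. K w ^ k * r (y0 - h * w) \<partial>lborel)"
proof -
  have far: "\<bar>z / h\<bar> > R" if "y0 \<le> z" for z
  proof -
    have "z / h > R"
      using h that by (simp add: pos_less_divide_eq mult.commute)
    then show ?thesis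
      by linarith
  qed
  have y0: "y0 > 0"
    using h R by (smt (verit) mult_pos_pos)
  have "indicator {0<..} y * (r y * (K ((y0 - y) / h) + K ((y0 + y) / h)) ^ k) =
      r y * K ((y0 - y) / h) ^ k" for y
  proof (cases "y > 0")
    case True
    have "K ((y0 + y) / h) = 0"
      using True by (intro supp far) simp
    then show ?thesis
      using True by simp
  next
    case False
    have "K ((y0 - y) / h) = 0"
      using False by (intro supp far) simp
    then show ?thesis
      \<comment> \<open>Here \<open>k > 0\<close> guarantees that \<open>0 ^ k = 0\<close>.\<close>
      using False k by simp
  qed
  then have "(\<integral>y. indicator {0<..} y * (r y * (K ((y0 - y) / h) + K ((y0 + y) / h)) ^ k) \<partial>lborel) =
      (\<integral>y. r y * K ((y0 - y) / h) ^ k \<partial>lborel)"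
    by (simp only:)
  \<comment> \<open>Substitution \<open>y = y0 - h * w\<close>.\<close>
  also have "\<dots> = \<bar>- h\<bar> *\<^sub>R (\<integral>w. r (y0 + (- h) * w) * K ((y0 - (y0 + (- h) * w)) / h) ^ k \<partial>lborel)"
    using h by (intro lborel_integral_real_affine) simp
  also have "\<dots> = h * (\<integral>w. K w ^ k * r (y0 - h * w) \<partial>lborel)"
    using h by (simp add: mult.commute)
  finally show ?thesis .
qed

text \<open>For the first estimate \<open>r\<close> is replaced by its quadratic Taylor polynomial,
  whose linear term integrates to \<open>0\<close> by symmetry of \<open>K\<close>; for the second,
  by the constant \<open>r x\<close>.\<close>

lemma kernel_smoothing_expansion:
  fixes K r :: "real \<Rightarrow> real"
  assumes K: "smoothing_kernel K" and r: "cont_diff_near 3 r x"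
  obtains \<epsilon> D where "\<epsilon> > 0" "D \<ge> 0"
    "\<And>h. 0 < h \<Longrightarrow> h \<le> \<epsilon> \<Longrightarrow>
      \<bar>(\<integral>w. K w * r (x - h * w) \<partial>lborel) - r x - h\<^sup>2 * ((deriv ^^ 2) r x / 2) * (LBINT w. K w * w\<^sup>2)\<bar>
        \<le> D * h ^ 3"
    "\<And>h. 0 < h \<Longrightarrow> h \<le> \<epsilon> \<Longrightarrow>
      \<bar>(\<integral>w. (K w)\<^sup>2 * r (x - h * w) \<partial>lborel) - r x * (LBINT w. (K w)\<^sup>2)\<bar> \<le> D * h"
proof -
  note Km[measurable] = smoothing_kernelD(1)[OF K]
  obtain B R where R: "R > 0" and bound: "\<And>w. \<bar>K w\<bar> \<le> B" and supp: "\<And>w. \<bar>w\<bar> > R \<Longrightarrow> K w = 0"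
    using smoothing_kernelD(4)[OF K] by blast
  obtain \<delta> C where \<delta>: "\<delta> > 0" and C: "C \<ge> 0" and cont: "continuous_on (cball x \<delta>) r"
    and taylor: "\<And>u m. \<bar>u\<bar> \<le> \<delta> \<Longrightarrow> 0 < m \<Longrightarrow> m \<le> 3 \<Longrightarrow>
      \<bar>r (x + u) - (\<Sum>j<m. (deriv ^^ j) r x / fact j * u ^ j)\<bar> \<le> C * \<bar>u\<bar> ^ m"
    using cont_diff_near_taylor[OF r] by auto
  have intK: "integrable lborel (\<lambda>w. K w * w ^ j)" for j
    by (rule integrable_bounded_support_mult[OF Km bound supp]) (auto intro: continuous_intros)
  have sq_bound: "\<bar>(K w)\<^sup>2\<bar> \<le> B\<^sup>2" for w
    using bound[of w] power_mono[of "\<bar>K w\<bar>" B 2] by simp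
  have sq_supp: "(K w)\<^sup>2 = 0" if "\<bar>w\<bar> > R" for w
    using supp[OF that] by simp
  have sq_m: "(\<lambda>w. (K w)\<^sup>2) \<in> borel_measurable borel"
    by measurable
  \<comment> \<open>The substitution of \<open>- w\<close> for \<open>w\<close> shows that the
    integral equals its own negative.\<close>
  have odd: "(LBINT w. K w * w) = 0"
    using lborel_integral_real_affine[of "-1" "\<lambda>w. K w * w" 0] smoothing_kernelD(2)[OF K]
    by simp
  define P where "P u = (\<Sum>j<3. (deriv ^^ j) r x / fact j * u ^ j)" for u
  have "(\<integral>w. K w * P (- (h * w)) \<partial>lborel) =
      r x + h\<^sup>2 * ((deriv ^^ 2) r x / 2) * (LBINT w. K w * w\<^sup>2)" for h
  proof -
    have "K w * P (- (h * w)) = r x * (K w * w ^ 0) - h * deriv r x * (K w * w ^ 1) +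
        h\<^sup>2 * ((deriv ^^ 2) r x / 2) * (K w * w ^ 2)" for w
      by (simp add: P_def numeral_3_eq_3 numeral_2_eq_2 algebra_simps)
    then show ?thesis
      using intK[of 0] intK[of 1] intK[of 2] smoothing_kernelD(3)[OF K] odd
      by simp
  qed
  note K1 = this
  have E1: "\<bar>(\<integral>w. K w * r (x - h * w) \<partial>lborel) - r x - h\<^sup>2 * ((deriv ^^ 2) r x / 2) * (LBINT w. K w * w\<^sup>2)\<bar>
      \<le> 2 * B * C * R ^ Suc 3 * h ^ 3" if "0 < h" "h * R \<le> \<delta>" for h
  proof -
    have "\<bar>(\<integral>w. K w * r (x - h * w) \<partial>lborel) - (\<integral>w. K w * P (- (h * w)) \<partial>lborel)\<bar> \<le>
        2 * B * C * R ^ Suc 3 * h ^ 3"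
    proof (rule kernel_integral_remainder[OF Km bound supp R that cont])
      show "continuous_on UNIV P"
        unfolding P_def by (intro continuous_intros)
      show "\<bar>r (x + u) - P u\<bar> \<le> C * \<bar>u\<bar> ^ 3" if "\<bar>u\<bar> \<le> \<delta>" for u
        unfolding P_def using that by (intro taylor) auto
    qed
    then show ?thesis
      unfolding K1 by (simp add: algebra_simps)
  qed
  have E2: "\<bar>(\<integral>w. (K w)\<^sup>2 * r (x - h * w) \<partial>lborel) - r x * (LBINT w. (K w)\<^sup>2)\<bar> \<le>
      2 * B\<^sup>2 * C * R ^ Suc 1 * h ^ 1" if "0 < h" "h * R \<le> \<delta>" for h
  proof -
    have "\<bar>(\<integral>w. (K w)\<^sup>2 * r (x - h * w) \<partial>lborel) - (\<integral>w. (K w)\<^sup>2 * r x \<partial>lborel)\<bar> \<le>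
        2 * B\<^sup>2 * C * R ^ Suc 1 * h ^ 1"
      by (rule kernel_integral_remainder[OF sq_m sq_bound sq_supp R that cont, where P = "\<lambda>_. r x"])
        (use taylor[of _ 1] in auto)
    then show ?thesis
      by (simp add: mult.commute)
  qed
  define D where "D = max (2 * B * C * R ^ Suc 3) (2 * B\<^sup>2 * C * R ^ Suc 1)"
  show thesis
  proof (rule that[of "\<delta> / R" D])
    show "\<delta> / R > 0"
      using \<delta> R by simp
    have "0 \<le> 2 * B\<^sup>2 * C * R ^ Suc 1"
      using C R by simp
    then show "D \<ge> 0"
      unfolding D_def by linarith
    show "\<bar>(\<integral>w. K w * r (x - h * w) \<partial>lborel) - r x - h\<^sup>2 * ((deriv ^^ 2) r x / 2) * (LBINT w. K w * w\<^sup>2)\<bar>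
        \<le> D * h ^ 3" if "0 < h" "h \<le> \<delta> / R" for h
    proof -
      have "h * R \<le> \<delta>"
        using that R by (simp add: pos_le_divide_eq)
      then show ?thesis
        using that by (intro order_trans[OF E1] mult_right_mono) (auto simp: D_def)
    qed
    show "\<bar>(\<integral>w. (K w)\<^sup>2 * r (x - h * w) \<partial>lborel) - r x * (LBINT w. (K w)\<^sup>2)\<bar> \<le> D * h"
      if "0 < h" "h \<le> \<delta> / R" for h
    proof -
      have "h * R \<le> \<delta>"
        using that R by (simp add: pos_le_divide_eq)
      then have "\<bar>(\<integral>w. (K w)\<^sup>2 * r (x - h * w) \<partial>lborel) - r x * (LBINT w. (K w)\<^sup>2)\<bar> \<le> D * h ^ 1"
        using that by (intro order_trans[OF E2] mult_right_mono) (auto simp: D_def)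
      then show ?thesis
        by simp
    qed
  qed
qed

subsection \<open>Moments of the estimator\<close>

text \<open>Induction on \<open>I\<close>: a new summand is independent of the partial sum, so the
  expectation of their product factorizes. Boundedness supplies all integrability.\<close>

lemma (in prob_space) variance_sum_indep_bounded:
  fixes Y :: "'i \<Rightarrow> 'a \<Rightarrow> real"
  assumes "finite I" and indep: "indep_vars (\<lambda>_. borel) Y I"
    and bound: "\<And>i \<omega>. i \<in> I \<Longrightarrow> \<bar>Y i \<omega>\<bar> \<le> B"
  shows "variance (\<lambda>\<omega>. \<Sum>i\<in>I. Y i \<omega>) = (\<Sum>i\<in>I. variance (Y i))"
  using assms
proof (induction I rule: finite_induct)
  case (insert i I)
  let ?S = "\<lambda>\<omega>. \<Sum>i\<in>I. Y i \<omega>"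
  have meas[measurable]: "Y j \<in> borel_measurable M" if "j \<in> insert i I" for j
    using insert.prems(1) that unfolding indep_vars_def by auto
  have int: "integrable M (Y j)" "integrable M (\<lambda>\<omega>. (Y j \<omega>)\<^sup>2)" if "j \<in> insert i I" for j
  proof -
    show "integrable M (Y j)"
      using that insert.prems(2) by (intro integrable_const_bound[of _ B] meas) auto
    have "(Y j \<omega>)\<^sup>2 \<le> B\<^sup>2" for \<omega>
      using insert.prems(2)[OF that, of \<omega>] by (simp add: abs_le_square_iff[symmetric])
    then show "integrable M (\<lambda>\<omega>. (Y j \<omega>)\<^sup>2)"
      using meas[OF that] by (intro integrable_const_bound[of _ "B\<^sup>2"]) auto
  qed
  have Sb: "\<bar>?S \<omega>\<bar> \<le> real (card I) * B" for \<omega>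
    using insert.prems(2) by (intro order_trans[OF sum_abs] sum_bounded_above) auto
  have Sm[measurable]: "?S \<in> borel_measurable M"
    using meas by auto
  have intS: "integrable M ?S" "integrable M (\<lambda>\<omega>. (?S \<omega>)\<^sup>2)"
  proof -
    show "integrable M ?S"
      using Sb by (intro integrable_const_bound[of _ "real (card I) * B"]) auto
    have "(?S \<omega>)\<^sup>2 \<le> (real (card I) * B)\<^sup>2" for \<omega>
      using Sb[of \<omega>] by (simp add: abs_le_square_iff[symmetric])
    then show "integrable M (\<lambda>\<omega>. (?S \<omega>)\<^sup>2)"
      by (intro integrable_const_bound[of _ "(real (card I) * B)\<^sup>2"]) auto
  qed
  have ind: "indep_var borel (Y i) borel ?S"
    using insert.hyps insert.prems(1) by (intro indep_vars_sum)
  have prod: "expectation (\<lambda>\<omega>. Y i \<omega> * ?S \<omega>) = expectation (Y i) * expectation ?S"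
      "integrable M (\<lambda>\<omega>. Y i \<omega> * ?S \<omega>)"
    using indep_var_lebesgue_integral[OF ind int(1) intS(1)] indep_var_integrable[OF ind int(1) intS(1)]
    by auto
  have sq: "(\<lambda>\<omega>. (Y i \<omega> + ?S \<omega>)\<^sup>2) = (\<lambda>\<omega>. (Y i \<omega>)\<^sup>2 + (?S \<omega>)\<^sup>2 + 2 * (Y i \<omega> * ?S \<omega>))"
    by (simp add: power2_sum fun_eq_iff mult.assoc)
  have i2: "integrable M (\<lambda>\<omega>. (Y i \<omega> + ?S \<omega>)\<^sup>2)"
    unfolding sq using int intS prod by auto
  have "variance (\<lambda>\<omega>. Y i \<omega> + ?S \<omega>) = variance (Y i) + variance ?S"
    using int[of i] intS prod i2
    by (simp add: variance_eq) (simp add: sq power2_eq_square algebra_simps prob_space)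
  moreover have "variance ?S = (\<Sum>i\<in>I. variance (Y i))"
    using insert.prems by (intro insert.IH indep_vars_subset[OF insert.prems(1)]) auto
  ultimately show ?case
    using insert.hyps by simp
qed simp

text \<open>Exact formulas, valid once \<open>h * R < psi d a \<xi>\<close>. The estimator is a
  constant times a sum of independent bounded variables whose \<open>k\<close>-th moments are
  \<open>s_const d * h * I k\<close>.\<close>

lemma (in prob_space) g_hat_moments:
  fixes \<mu> :: "real^'n" and S :: "real^'n^'n" and X :: "nat \<Rightarrow> 'a \<Rightarrow> real^'n"
    and g K :: "real \<Rightarrow> real" and a \<xi> h B R :: real and n :: nat
  defines "d \<equiv> CARD('n)"
  defines "c \<equiv> \<xi> powr ((- real d + 2) / 2) * deriv (psi d a) \<xi>"
    and "I \<equiv> \<lambda>k. (\<integral>w. K w ^ k * rho d a g (psi d a \<xi> - h * w) \<partial>lborel)"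
  assumes S: "pos_def_matrix S" and a: "a > 0"
    and g_nonneg: "\<And>t. t \<ge> 0 \<Longrightarrow> g t \<ge> 0"
    and f: "elliptical_density \<mu> S g \<in> borel_measurable borel"
    and indep: "indep_vars (\<lambda>_. borel) X {1..n}"
    and distr: "\<And>i. i \<in> {1..n} \<Longrightarrow>
      distributed M lborel (X i) (\<lambda>x. ennreal (elliptical_density \<mu> S g x))"
    and K[measurable]: "K \<in> borel_measurable borel"
    and bound: "\<And>w. \<bar>K w\<bar> \<le> B" and supp: "\<And>w. \<bar>w\<bar> > R \<Longrightarrow> K w = 0" and R: "R > 0"
    and h: "h > 0" "h * R < psi d a \<xi>" and n: "n > 0"
  defines "G \<equiv> \<lambda>\<omega>. g_hat d K n h a (\<lambda>i. mahalanobis_sq \<mu> S (X i \<omega>)) \<xi>"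
  shows "expectation G = c * I 1"
    and "variance G = c\<^sup>2 * I 2 / (real n * h * s_const d) - c\<^sup>2 * (I 1)\<^sup>2 / real n"
proof -
  have d: "d > 0"
    by (simp add: d_def)
  define s where "s = s_const d"
  have s: "s > 0"
    using s_const_pos[OF d] by (simp add: s_def)
  have f0: "elliptical_density \<mu> S g x \<ge> 0" for x
    using g_nonneg[OF mahalanobis_sq_nonneg[OF S]] by (simp add: elliptical_density_def)
  \<comment> \<open>The kernel and its reflection at \<open>0\<close>, as a function of the
    transformed distance of one sample point.\<close>
  define T where "T y = K ((psi d a \<xi> - y) / h) + K ((psi d a \<xi> + y) / h)" for y
  have T[measurable]: "T \<in> borel_measurable borel"
    unfolding T_def by measurable
  have Tb: "\<bar>T y\<bar> \<le> 2 * B" for y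
    unfolding T_def
    using bound[of "(psi d a \<xi> - y) / h"] bound[of "(psi d a \<xi> + y) / h"] by linarith
  define V where "V x = T (psi d a (mahalanobis_sq \<mu> S x))" for x
  have V[measurable]: "V \<in> borel_measurable borel"
    unfolding V_def by measurable
  define W where "W i \<omega> = V (X i \<omega>)" for i \<omega>
  have mom: "expectation (\<lambda>\<omega>. W i \<omega> ^ k) = s * h * I k" if "i \<in> {1..n}" "k > 0" for i k
  proof -
    have "expectation (\<lambda>\<omega>. W i \<omega> ^ k) = (\<integral>x. elliptical_density \<mu> S g x * V x ^ k \<partial>lborel)"
      unfolding W_def using f0
      by (intro distributed_integral[OF distr[OF that(1)], symmetric]) auto
    also have "\<dots> = s * (\<integral>y. indicator {0<..} y * (rho d a g y * T y ^ k) \<partial>lborel)"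
      unfolding V_def s_def d_def
      by (rule integral_elliptical_density[OF S a f, of "\<lambda>y. T y ^ k"]) measurable
    also have "\<dots> = s * (h * I k)"
      unfolding I_def T_def using reflected_kernel_integral[of R K, OF supp h R that(2)] by simp
    finally show ?thesis
      by simp
  qed
  have indW: "indep_vars (\<lambda>_. borel) W {1..n}"
    unfolding W_def by (rule indep_vars_compose2[OF indep]) auto
  have Wm[measurable]: "W i \<in> borel_measurable M" if "i \<in> {1..n}" for i
    using indW that unfolding indep_vars_def by auto
  have Wb: "\<bar>W i \<omega>\<bar> \<le> 2 * B" for i \<omega>
    unfolding W_def V_def by (rule Tb)
  have Wint: "integrable M (W i)" if "i \<in> {1..n}" for i
    using Wb by (intro integrable_const_bound[of _ "2 * B"] Wm that) auto
  have W2int: "integrable M (\<lambda>\<omega>. (W i \<omega>)\<^sup>2)" if "i \<in> {1..n}" for i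
  proof -
    have "(W i \<omega>)\<^sup>2 \<le> (2 * B)\<^sup>2" for \<omega>
      by (rule power2_le_iff_abs_le[THEN iffD2]) (use Wb[of i \<omega>] in auto)
    then show ?thesis
      using Wm[OF that] by (intro integrable_const_bound[of _ "(2 * B)\<^sup>2"]) auto
  qed
  define b where "b = c / (real n * h * s)"
  have G: "G = (\<lambda>\<omega>. b * (\<Sum>i\<in>{1..n}. W i \<omega>))"
    by (simp add: G_def g_hat_def b_def c_def W_def V_def T_def s_def fun_eq_iff)
  have EW: "expectation (W i) = s * h * I 1" if "i \<in> {1..n}" for i
    using mom[OF that, of 1] by simp
  have ES: "expectation (\<lambda>\<omega>. \<Sum>i\<in>{1..n}. W i \<omega>) = real n * (s * h * I 1)"
    using Wint EW by simp
  show "expectation G = c * I 1"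
    unfolding G using ES n h s by (simp add: b_def)
  have "variance G = b\<^sup>2 * variance (\<lambda>\<omega>. \<Sum>i\<in>{1..n}. W i \<omega>)"
    unfolding G by (simp add: power_mult_distrib flip: right_diff_distrib)
  also have "variance (\<lambda>\<omega>. \<Sum>i\<in>{1..n}. W i \<omega>) = (\<Sum>i\<in>{1..n}. variance (W i))"
    by (rule variance_sum_indep_bounded[OF _ indW Wb]) simp
  also have "\<dots> = (\<Sum>i\<in>{1..n}. s * h * I 2 - (s * h * I 1)\<^sup>2)"
  proof (intro sum.cong refl)
    fix i assume i: "i \<in> {1..n}"
    show "variance (W i) = s * h * I 2 - (s * h * I 1)\<^sup>2"
      using variance_eq[OF Wint[OF i] W2int[OF i]] mom[OF i, of 2] EW[OF i] by simp
  qed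
  also have "b\<^sup>2 * \<dots> = c\<^sup>2 * I 2 / (real n * h * s) - c\<^sup>2 * (I 1)\<^sup>2 / real n"
    using n h s by (simp add: b_def power2_eq_square field_simps)
  finally show "variance G = c\<^sup>2 * I 2 / (real n * h * s_const d) - c\<^sup>2 * (I 1)\<^sup>2 / real n"
    by (simp add: s_def)
qed

text \<open>Each sample size has its own probability space \<open>M n\<close>, since the moments
  involve only the joint law of the \<open>n\<close> points. The expansions of the kernel integrals
  are inserted into the exact moments.\<close>

theorem theorem2p1:
  fixes \<mu> :: "real ^ 'n" and S :: "real ^ 'n ^ 'n" and g K :: "real \<Rightarrow> real"
    and M :: "nat \<Rightarrow> 'a measure" and X :: "nat \<Rightarrow> nat \<Rightarrow> 'a \<Rightarrow> real ^ 'n"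
    and h :: "nat \<Rightarrow> real" and a \<xi> :: real and d :: nat
    and ghat :: "nat \<Rightarrow> 'a \<Rightarrow> real"
  defines "d \<equiv> CARD('n)"
    and "ghat \<equiv> \<lambda>n \<omega>. g_hat d K n (h n) a (\<lambda>i. mahalanobis_sq \<mu> S (X n i \<omega>)) \<xi>"
  assumes S: "pos_def_matrix S"
    and g_nonneg: "\<And>t. t \<ge> 0 \<Longrightarrow> g t \<ge> 0"
    and f_measurable: "elliptical_density \<mu> S g \<in> borel_measurable borel"
    and f_integral: "(\<integral>\<^sup>+ x. ennreal (elliptical_density \<mu> S g x) \<partial>lborel) = 1"
    and M: "\<And>n. prob_space (M n)"
    and indep: "\<And>n. prob_space.indep_vars (M n) (\<lambda>_. borel) (X n) {1..n}"
    and distr: "\<And>n i. i \<in> {1..n} \<Longrightarrow>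
      distributed (M n) lborel (X n i) (\<lambda>x. ennreal (elliptical_density \<mu> S g x))"
    and K: "smoothing_kernel K"
    and h_pos: "\<And>n. h n > 0" and h_lim: "h \<longlonglongrightarrow> 0"
    and a: "a > 0" and \<xi>: "\<xi> > 0"
    and rho_smooth: "cont_diff_near 3 (rho d a g) (psi d a \<xi>)"
  shows "(\<lambda>n. prob_space.expectation (M n) (ghat n) - g \<xi>
            - (h n)\<^sup>2 * (deriv (psi d a) \<xi> * (deriv ^^ 2) (rho d a g) (psi d a \<xi>)
                         / (2 * \<xi> powr ((real d - 2) / 2)))
                * (LBINT w. K w * w\<^sup>2))
          \<in> O(\<lambda>n. (h n) ^ 3) \<and>
         (\<lambda>n. prob_space.variance (M n) (ghat n)
            - deriv (psi d a) \<xi> * g \<xi> * (LBINT w. (K w)\<^sup>2)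
                / (real n * h n * s_const d * \<xi> powr ((real d - 2) / 2)))
          \<in> o(\<lambda>n. inverse (real n * h n))"
proof -
  have d: "d > 0"
    by (simp add: d_def)
  define y0 where "y0 = psi d a \<xi>"
  have y0: "y0 > 0"
    using psi_strict_mono[OF d _ \<xi>, of a] psi_zero[OF d a] by (simp add: y0_def)
  define r where "r = rho d a g"
  define c where "c = \<xi> powr ((- real d + 2) / 2) * deriv (psi d a) \<xi>"
  define s where "s = s_const d"
  have s: "s > 0"
    using s_const_pos[OF d] by (simp add: s_def)
  have c_eq: "c = deriv (psi d a) \<xi> / \<xi> powr ((real d - 2) / 2)"
  proof -
    have "(- real d + 2) / 2 = - ((real d - 2) / 2)"
      by (simp add: field_simps)
    then show ?thesis
      unfolding c_def by (simp only: powr_minus) (simp add: field_simps)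
  qed
  have "r y0 = \<xi> powr ((real d - 2) / 2) * g \<xi> / deriv (psi d a) \<xi>"
    using \<xi> by (simp add: r_def rho_def y0_def psi_inv_psi[OF d a] z_fun_def)
  \<comment> \<open>The prefactor of the estimator undoes the passage from \<open>g\<close> to
    \<open>rho\<close>.\<close>
  then have cr: "c * r y0 = g \<xi>"
    using deriv_psi_pos[OF d a \<xi>] \<xi> by (simp add: c_eq)
  obtain B R where R: "R > 0" and bound: "\<And>w. \<bar>K w\<bar> \<le> B" and supp: "\<And>w. \<bar>w\<bar> > R \<Longrightarrow> K w = 0"
    using smoothing_kernelD(4)[OF K] by blast
  define I where "I k t = (\<integral>w. K w ^ k * r (y0 - t * w) \<partial>lborel)" for k t
  define r2 where "r2 = (deriv ^^ 2) r y0 / 2"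
  define m2 where "m2 = (LBINT w. K w * w\<^sup>2)"
  define k2 where "k2 = (LBINT w. (K w)\<^sup>2)"
  obtain \<epsilon> D where \<epsilon>: "\<epsilon> > 0" and D: "D \<ge> 0"
    and expansion: "\<And>t. 0 < t \<Longrightarrow> t \<le> \<epsilon> \<Longrightarrow>
      \<bar>(\<integral>w. K w * r (y0 - t * w) \<partial>lborel) - r y0 - t\<^sup>2 * ((deriv ^^ 2) r y0 / 2) * (LBINT w. K w * w\<^sup>2)\<bar>
        \<le> D * t ^ 3"
    "\<And>t. 0 < t \<Longrightarrow> t \<le> \<epsilon> \<Longrightarrow>
      \<bar>(\<integral>w. (K w)\<^sup>2 * r (y0 - t * w) \<partial>lborel) - r y0 * (LBINT w. (K w)\<^sup>2)\<bar> \<le> D * t"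
    using kernel_smoothing_expansion[OF K rho_smooth[folded r_def y0_def]] by blast
  have I1: "\<bar>I 1 t - r y0 - t\<^sup>2 * r2 * m2\<bar> \<le> D * t ^ 3"
    and I2: "\<bar>I 2 t - r y0 * k2\<bar> \<le> D * t" if "0 < t" "t \<le> \<epsilon>" for t
    using expansion[OF that] by (simp_all only: I_def r2_def m2_def k2_def power_one_right)
  \<comment> \<open>A bound on the first kernel integral for \<open>t \<le> 1\<close>; it controls
    the squared mean in the variance.\<close>
  define A where "A = \<bar>r y0\<bar> + \<bar>r2 * m2\<bar> + D"
  have A: "\<bar>I 1 t\<bar> \<le> A" if "0 < t" "t \<le> \<epsilon>" "t \<le> 1" for t
  proof -
    have "t\<^sup>2 * \<bar>r2 * m2\<bar> \<le> 1 * \<bar>r2 * m2\<bar>" "D * t ^ 3 \<le> D * 1"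
      using that D by (intro mult_right_mono mult_left_mono power_le_one; simp)+
    moreover have "\<bar>t\<^sup>2 * r2 * m2\<bar> = t\<^sup>2 * \<bar>r2 * m2\<bar>"
      by (simp add: abs_mult mult.assoc)
    ultimately show ?thesis
      using I1[OF that(1,2)] unfolding A_def by linarith
  qed
  \<comment> \<open>Below \<open>b\<close> the expansions and the bound \<open>A\<close> hold, and
    \<open>h n * R < y0\<close> keeps the kernel away from the boundary.\<close>
  define b where "b = min (min \<epsilon> 1) (y0 / (2 * R))"
  have "b > 0"
    using \<epsilon> y0 R by (simp add: b_def)
  then have ev: "\<forall>\<^sub>F n in sequentially. n > 0 \<and> h n < b"
    using order_tendstoD(2)[OF h_lim] eventually_gt_at_top[of 0] by (intro eventually_conj)
  have moments: "prob_space.expectation (M n) (ghat n) = c * I 1 (h n)"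
    "prob_space.variance (M n) (ghat n) = c\<^sup>2 * I 2 (h n) / (real n * h n * s) - c\<^sup>2 * (I 1 (h n))\<^sup>2 / real n"
    "h n \<le> \<epsilon>" "h n \<le> 1"
    if "n > 0 \<and> h n < b" for n
  proof -
    interpret prob_space "M n"
      by (rule M)
    show "h n \<le> \<epsilon>" "h n \<le> 1"
      using that by (auto simp: b_def)
    have "h n * R < y0"
    proof -
      have "h n < y0 / (2 * R)"
        using that by (simp add: b_def)
      then have "h n * (2 * R) < y0"
        using R by (simp add: pos_less_divide_eq)
      then show ?thesis
        using y0 by linarith
    qed
    then show "prob_space.expectation (M n) (ghat n) = c * I 1 (h n)"
      "prob_space.variance (M n) (ghat n) = c\<^sup>2 * I 2 (h n) / (real n * h n * s) - c\<^sup>2 * (I 1 (h n))\<^sup>2 / real n"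
      using g_hat_moments[OF S a g_nonneg f_measurable indep[of n] distr smoothing_kernelD(1)[OF K]
          bound supp R h_pos[of n], where \<xi> = \<xi>] that
      unfolding ghat_def c_def I_def r_def y0_def s_def d_def by simp_all
  qed
  let ?E = "\<lambda>n. prob_space.expectation (M n) (ghat n) - g \<xi>
    - (h n)\<^sup>2 * (deriv (psi d a) \<xi> * (deriv ^^ 2) (rho d a g) (psi d a \<xi>)
        / (2 * \<xi> powr ((real d - 2) / 2))) * (LBINT w. K w * w\<^sup>2)"
  let ?V = "\<lambda>n. prob_space.variance (M n) (ghat n)
    - deriv (psi d a) \<xi> * g \<xi> * (LBINT w. (K w)\<^sup>2)
        / (real n * h n * s_const d * \<xi> powr ((real d - 2) / 2))"
  have "?E \<in> O(\<lambda>n. h n ^ 3)"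
  proof (rule bigoI[where c = "\<bar>c\<bar> * D"])
    show "\<forall>\<^sub>F n in sequentially. norm (?E n) \<le> \<bar>c\<bar> * D * norm (h n ^ 3)"
      using ev
    proof eventually_elim
      case (elim n)
      have "?E n = c * (I 1 (h n) - r y0 - (h n)\<^sup>2 * r2 * m2)"
        unfolding moments(1)[OF elim] cr[symmetric]
        by (simp add: r2_def m2_def c_eq r_def y0_def algebra_simps)
      then have "norm (?E n) \<le> \<bar>c\<bar> * (D * h n ^ 3)"
        using I1[OF h_pos moments(3)[OF elim]] by (simp add: abs_mult mult_left_mono)
      then show ?case
        using h_pos[of n] by (simp add: mult.assoc)
    qed
  qed
  moreover have "?V \<in> o(\<lambda>n. inverse (real n * h n))"
  proof (rule landau_o.smallI)
    fix e :: real
    assume e: "e > 0"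
    \<comment> \<open>The first summand bounds the error of the second moment. The second bounds the
      squared mean, which is of order \<open>1 / n\<close> and so carries an extra factor
      \<open>h n\<close> relative to \<open>1 / (n * h n)\<close>.\<close>
    define L where "L = c\<^sup>2 * D / s + c\<^sup>2 * A\<^sup>2"
    have "((\<lambda>n. L * h n) \<longlongrightarrow> 0) sequentially"
      using tendsto_mult_right_zero[OF h_lim] by simp
    then have "\<forall>\<^sub>F n in sequentially. L * h n < e"
      using e order_tendstoD(2) by blast
    with ev show "\<forall>\<^sub>F n in sequentially. norm (?V n) \<le> e * norm (inverse (real n * h n))"
    proof eventually_elim
      case (elim n)
      have n: "real n > 0" and hn: "h n > 0"
        using elim h_pos by auto
      let ?e1 = "c\<^sup>2 * (I 2 (h n) - r y0 * k2) / s" and ?e2 = "c\<^sup>2 * (I 1 (h n))\<^sup>2 * h n"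
      \<comment> \<open>As \<open>g \<xi> = c * r y0\<close>, the claimed leading term is the exact
        one with \<open>I 2 (h n)\<close> replaced by its limit \<open>r y0 * k2\<close>.\<close>
      have "deriv (psi d a) \<xi> * g \<xi> * (LBINT w. (K w)\<^sup>2)
          / (real n * h n * s_const d * \<xi> powr ((real d - 2) / 2)) =
          c\<^sup>2 * (r y0 * k2) / (real n * h n * s)"
        unfolding cr[symmetric] by (simp add: k2_def s_def c_eq power2_eq_square mult_ac)
      then have V: "?V n = inverse (real n * h n) * (?e1 - ?e2)"
        using n hn s unfolding moments(2)[OF elim(1)] by (simp add: field_simps)
      have "\<bar>?e1 - ?e2\<bar> \<le> L * h n"
      proof -
        have "\<bar>?e1\<bar> \<le> c\<^sup>2 * (D * h n) / s"
          using I2[OF h_pos moments(3)[OF elim(1)]] s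
          by (simp add: abs_mult divide_right_mono mult_left_mono)
        moreover have "(I 1 (h n))\<^sup>2 \<le> A\<^sup>2"
          using power_mono[OF A[OF h_pos moments(3,4)[OF elim(1)]], of 2] by simp
        then have "\<bar>?e2\<bar> \<le> c\<^sup>2 * A\<^sup>2 * h n"
          using hn by (simp add: abs_mult mult_left_mono mult_right_mono)
        ultimately have "\<bar>?e1\<bar> + \<bar>?e2\<bar> \<le> c\<^sup>2 * (D * h n) / s + c\<^sup>2 * A\<^sup>2 * h n"
          by (rule add_mono)
        also have "\<dots> = L * h n"
          by (simp add: L_def algebra_simps)
        finally show ?thesis
          by (rule order_trans[OF abs_triangle_ineq4])
      qed
      then have "\<bar>?e1 - ?e2\<bar> \<le> e"
        using elim(2) by linarith
      then have "inverse (real n * h n) * \<bar>?e1 - ?e2\<bar> \<le> inverse (real n * h n) * e"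
        using n hn by (intro mult_left_mono) auto
      then show ?case
        unfolding V real_norm_def abs_mult[of "inverse (real n * h n)"]
        using n hn by (simp add: mult.commute)
    qed
  qed
  ultimately show ?thesis
    by blast
qed

end
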